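(* Let $\mathbb{F}$ be an ordered subfield of $\mathbb{R}$. Then $\mathbb{F}$ is complete if and only if for all $a,b\in\mathbb{F}$ with $a<b$, every continuous function $f:[a,b]_{\mathbb{F}}\to\mathbb{F}$ is Riemann-integrable in $\mathbb{F}$ (consequently, its signed "area function" $x\mapsto\int_a^x f(t)\,dt\in\mathbb{F}$ is defined on the whole interval $[a,b]_{\mathbb{F}}$).
   Context: $\mathbb{F}$ denotes a subfield of $\mathbb{R}$ with the induced order, and $\mathbb{F}^+$ is the set of its positive elements. "$\mathbb{F}$ is complete" means every nonempty subset of $\mathbb{F}$ bounded above has a supremum in $\mathbb{F}$; equivalently, $\mathbb{F}=\mathbb{R}$. For $a,b\in\mathbb{F}$, $a<b$, write $[a,b]_{\mathbb{F}}=[a,b]\cap\mathbb{F}$, where $[a,b]$ is the real interval. Continuity is in the usual $\epsilon$-$\delta$ sense with $\epsilon,\delta\in\mathbb{F}^+$. Riemann integral in $\mathbb{F}$: the definition is formally identical to the usual one, with everything taken inside $\mathbb{F}$. A function $f:[a,b]_{\mathbb{F}}\to\mathbb{F}$ is Riemann-integrable if the Riemann sums, formed with partition points and sample points in $\mathbb{F}$, converge in $\mathbb{F}$: there is $I\in\mathbb{F}$ such that for every $\epsilon\in\mathbb{F}^+$ there is $\delta\in\mathbb{F}^+$ with $\left|\sum_{i=1}^n f(\xi_i)(x_i-x_{i-1})-I\right|<\epsilon$ for every partition $a=x_0<x_1<\dots<x_n=b$ with all $x_i\in\mathbb{F}$ and mesh less than $\delta$, and all sample points $\xi_i\in[x_{i-1},x_i]_{\mathbb{F}}$.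 Then $\int_a^b f(x)\,dx:=I$; also $\int_a^a f(x)\,dx:=0$. *)

theory Defs
  imports Complex_Main "HOL-Library.FuncSet" "HOL-Algebra.Algebraic_Closure_Type"
begin

definition real_subfield :: "real set \<Rightarrow> bool" where
  "real_subfield F \<longleftrightarrow> subfield F (ring_of_type_algebra :: real ring)"

(* The supremum is the least upper bound inside the ordered set F, not the real one. *)
definition complete_in :: "real set \<Rightarrow> bool" where
  "complete_in F \<longleftrightarrow>
    (\<forall>S. S \<subseteq> F \<and> S \<noteq> {} \<and> (\<exists>u\<in>F. \<forall>x\<in>S. x \<le> u) \<longrightarrow>
      (\<exists>s\<in>F. (\<forall>x\<in>S. x \<le> s) \<and> (\<forall>u\<in>F. (\<forall>x\<in>S. x \<le> u) \<longrightarrow> s \<le> u)))"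

definition interval_in :: "real set \<Rightarrow> real \<Rightarrow> real \<Rightarrow> real set" where
  "interval_in F a b = {a..b} \<inter> F"

(* A function from interval_in F a b to F is represented by a total function on the reals that
   maps this set into F; the definitions below never use its values elsewhere. *)

definition continuous_in :: "real set \<Rightarrow> real \<Rightarrow> real \<Rightarrow> (real \<Rightarrow> real) \<Rightarrow> bool" where
  "continuous_in F a b f \<longleftrightarrow>
    (\<forall>x \<in> interval_in F a b. \<forall>\<epsilon>\<in>F. \<epsilon> > 0 \<longrightarrow>
      (\<exists>\<delta>\<in>F. \<delta> > 0 \<and> (\<forall>y \<in> interval_in F a b. \<bar>y - x\<bar> < \<delta> \<longrightarrow> \<bar>f y - f x\<bar> < \<epsilon>)))"

(* Only t 0, ..., t n and the sample points s 0, ..., s (n - 1) matter; s i is the sample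
   point of the subinterval from t i to t (Suc i). *)
definition tagged_partition_in ::
    "real set \<Rightarrow> real \<Rightarrow> real \<Rightarrow> nat \<Rightarrow> (nat \<Rightarrow> real) \<Rightarrow> (nat \<Rightarrow> real) \<Rightarrow> bool" where
  "tagged_partition_in F a b n t s \<longleftrightarrow>
    t 0 = a \<and> t n = b \<and> (\<forall>i\<le>n. t i \<in> F) \<and>
    (\<forall>i<n. t i < t (Suc i) \<and> s i \<in> interval_in F (t i) (t (Suc i)))"

definition has_integral_in :: "real set \<Rightarrow> real \<Rightarrow> real \<Rightarrow> (real \<Rightarrow> real) \<Rightarrow> real \<Rightarrow> bool" where
  "has_integral_in F a b f I \<longleftrightarrow>
    (if a = b then I = 0
     else I \<in> F \<and>
       (\<forall>\<epsilon>\<in>F. \<epsilon> > 0 \<longrightarrow>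
         (\<exists>\<delta>\<in>F. \<delta> > 0 \<and>
           (\<forall>n t s. tagged_partition_in F a b n t s \<and> (\<forall>i<n. t (Suc i) - t i < \<delta>) \<longrightarrow>
             \<bar>(\<Sum>i<n. f (s i) * (t (Suc i) - t i)) - I\<bar> < \<epsilon>))))"

definition riemann_integrable_in :: "real set \<Rightarrow> real \<Rightarrow> real \<Rightarrow> (real \<Rightarrow> real) \<Rightarrow> bool" where
  "riemann_integrable_in F a b f \<longleftrightarrow> (\<exists>I\<in>F. has_integral_in F a b f I)"

end

theory Submission
  imports Defs "HOL-Analysis.Henstock_Kurzweil_Integration"
begin

text \<open>If \<open>c\<close> is a real number outside \<open>F\<close>, then no jump \<open>c - 1/n\<close> of the step function
  \<open>x \<mapsto> \<lfloor>1/(c - x)\<rfloor>\<close> lies in \<open>F\<close>, because \<open>F\<close> contains the rationals. So this function is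
  locally constant on \<open>F\<close>, hence continuous there, but it is unbounded near \<open>c\<close>, which rules
  out Riemann integrability on an interval around \<open>c\<close>. Conversely, a complete \<open>F\<close> is the
  whole real line, where uniform continuity compares Riemann sums with the gauge integral.\<close>

section \<open>Closure and density of subfields of the reals\<close>

lemma real_subfield_closed:
  assumes "real_subfield F"
  shows real_subfield_0: "0 \<in> F" and real_subfield_1: "1 \<in> F"
    and real_subfield_add: "x \<in> F \<Longrightarrow> y \<in> F \<Longrightarrow> x + y \<in> F"
    and real_subfield_diff: "x \<in> F \<Longrightarrow> y \<in> F \<Longrightarrow> x - y \<in> F"
    and real_subfield_mult: "x \<in> F \<Longrightarrow> y \<in> F \<Longrightarrow> x * y \<in> F"
    and real_subfield_divide: "x \<in> F \<Longrightarrow> y \<in> F \<Longrightarrow> x / y \<in> F"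
proof -
  let ?R = "ring_of_type_algebra :: real ring"
  have F: "subfield F ?R"
    using assms by (simp add: real_subfield_def)
  interpret R: field ?R
    by (rule field_from_type_algebra)
  have sub: "subring F ?R"
    using F by (rule subfieldE)
  have ops: "\<zero>\<^bsub>?R\<^esub> = 0" "\<one>\<^bsub>?R\<^esub> = 1" "x \<oplus>\<^bsub>?R\<^esub> y = x + y" "x \<otimes>\<^bsub>?R\<^esub> y = x * y" for x y
    by (simp_all add: ring_of_type_algebra_def)
  \<comment> \<open>Negation and, below, inversion are derived operations of the ring record;
    uniqueness of additive and multiplicative inverses identifies them with \<open>-\<close> and
    \<open>inverse\<close>.\<close>
  have minus: "\<ominus>\<^bsub>?R\<^esub> x = - x" for x
    by (rule R.minus_equality) (simp_all add: ring_of_type_algebra_def)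
  show 0: "0 \<in> F" and "1 \<in> F"
    using subringE(2,3)[OF sub] by (simp_all add: ops)
  show add: "x + y \<in> F" if "x \<in> F" "y \<in> F" for x y
    using subringE(7)[OF sub that] by (simp add: ops)
  have "- x \<in> F" if "x \<in> F" for x
    using subringE(5)[OF sub that] by (simp add: minus)
  then show "x - y \<in> F" if "x \<in> F" "y \<in> F" for x y
    using add[of x "- y"] that by simp
  show mult: "x * y \<in> F" if "x \<in> F" "y \<in> F" for x y
    using subringE(6)[OF sub that] by (simp add: ops)
  have "inverse x \<in> F" if "x \<in> F" for x
  proof (cases "x = 0")
    case False
    then have "x \<in> F - {\<zero>\<^bsub>?R\<^esub>}" using that by (simp add: ops)
    then have "inv\<^bsub>?R\<^esub> x \<in> F" "x \<otimes>\<^bsub>?R\<^esub> inv\<^bsub>?R\<^esub> x = \<one>\<^bsub>?R\<^esub>"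
      using R.subfield_m_inv[OF F] by auto
    then show ?thesis
      using False by (metis ops(2,4) inverse_unique)
  qed (use 0 in simp)
  then show "x / y \<in> F" if "x \<in> F" "y \<in> F" for x y
    using mult[of x "inverse y"] that by (simp add: divide_inverse)
qed

lemma real_subfield_of_nat:
  assumes "real_subfield F"
  shows "of_nat n \<in> F"
  by (induction n) (auto intro: real_subfield_closed[OF assms])

lemma real_subfield_of_int:
  assumes "real_subfield F"
  shows "of_int z \<in> F"
  by (cases z rule: int_diff_cases)
     (simp add: real_subfield_of_nat[OF assms] real_subfield_diff[OF assms])

lemma Rats_subset_real_subfield:
  assumes "real_subfield F"
  shows "\<rat> \<subseteq> F"
  by (auto elim!: Rats_cases' intro!: real_subfield_divide[OF assms] real_subfield_of_int[OF assms])

lemma real_subfield_dense: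
  fixes x y :: real
  assumes "real_subfield F" "x < y"
  obtains q where "q \<in> F" "x < q" "q < y"
  using Rats_dense_in_real[OF assms(2)] Rats_subset_real_subfield[OF assms(1)] by blast

section \<open>Completeness and the real line\<close>

lemma complete_in_imp_UNIV:
  assumes F: "real_subfield F" and "complete_in F"
  shows "F = UNIV"
proof -
  have "r \<in> F" for r :: real
  proof -
    \<comment> \<open>The lower cut of \<open>r\<close> in \<open>F\<close>. Its supremum
      \<open>s\<close> in \<open>F\<close> must equal \<open>r\<close>: density would put a point of
      \<open>F\<close> strictly between them, contradicting that \<open>s\<close> is an upper bound
      or that it is the least one.\<close>
    let ?S = "{x \<in> F. x < r}"
    obtain q where q: "q \<in> F" "r - 1 < q" "q < r"
      using real_subfield_dense[OF F, of "r - 1" r] by auto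
    obtain u where u: "u \<in> F" "r < u" "u < r + 1"
      using real_subfield_dense[OF F, of r "r + 1"] by auto
    have "\<forall>x\<in>?S. x \<le> u" using u(2) by auto
    with q u(1) have S: "?S \<subseteq> F \<and> ?S \<noteq> {} \<and> (\<exists>u\<in>F. \<forall>x\<in>?S. x \<le> u)"
      by blast
    then obtain s where s: "s \<in> F" "\<forall>x\<in>?S. x \<le> s"
      and least: "\<forall>u\<in>F. (\<forall>x\<in>?S. x \<le> u) \<longrightarrow> s \<le> u"
      using assms(2)[unfolded complete_in_def, rule_format, OF S] by blast
    have "\<not> s < r"
    proof
      assume "s < r"
      then obtain p where "p \<in> F" "s < p" "p < r"
        using real_subfield_dense[OF F] by blast
      then show False using s by force
    qed
    moreover have "\<not> r < s"
    proof
      assume "r < s"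
      then obtain p where "p \<in> F" "r < p" "p < s"
        using real_subfield_dense[OF F] by blast
      then show False using least by force
    qed
    ultimately show "r \<in> F" using s(1) by (simp add: not_less_iff_gr_or_eq)
  qed
  then show ?thesis by blast
qed

section \<open>Integrability of continuous functions over the whole line\<close>

lemma tagged_partition_in_mono:
  assumes "tagged_partition_in F a b n t s" "i \<le> j" "j \<le> n"
  shows "t i \<le> t j"
  using assms(2,3)
proof (induction j rule: dec_induct)
  case (step j)
  moreover have "t j < t (Suc j)"
    using assms(1) step by (simp add: tagged_partition_in_def)
  ultimately show ?case by simp
qed simp

text \<open>On each subinterval the constant \<open>f (s i)\<close> stays within \<open>e\<close> of
  \<open>f\<close>, so that piece contributes an error of at most \<open>e\<close> times its length.
  Induction over the initial segments from \<open>a\<close> to \<open>t k\<close> adds these errors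
  up.\<close>

lemma riemann_sum_integral_bound:
  fixes f :: "real \<Rightarrow> real"
  assumes cont: "continuous_on {a..b} f"
    and part: "tagged_partition_in F a b n t s"
    and osc: "\<And>i x. i < n \<Longrightarrow> x \<in> {t i..t (Suc i)} \<Longrightarrow> \<bar>f (s i) - f x\<bar> \<le> e"
  shows "\<bar>(\<Sum>i<n. f (s i) * (t (Suc i) - t i)) - integral {a..b} f\<bar> \<le> e * (b - a)"
proof -
  have t0: "t 0 = a" and tn: "t n = b" and lt: "\<And>i. i < n \<Longrightarrow> t i < t (Suc i)"
    using part by (auto simp: tagged_partition_in_def)
  note mono = tagged_partition_in_mono[OF part]
  have "\<bar>(\<Sum>i<k. f (s i) * (t (Suc i) - t i)) - integral {a..t k} f\<bar> \<le> e * (t k - a)"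
    if "k \<le> n" for k
    using that
  proof (induction k)
    case 0
    then show ?case by (simp add: t0)
  next
    case (Suc k)
    let ?u = "t k" and ?v = "t (Suc k)"
    have u: "a \<le> ?u" "?u < ?v" "?v \<le> b"
      using mono[of 0 k] mono[of "Suc k" n] lt[of k] Suc.prems by (auto simp: t0 tn)
    have c: "continuous_on {x..y} f" if "a \<le> x" "y \<le> b" for x y
      using cont by (rule continuous_on_subset) (use that in auto)
    have split: "integral {a..?v} f = integral {a..?u} f + integral {?u..?v} f"
      using u c by (intro Henstock_Kurzweil_Integration.integral_combine[symmetric]
          integrable_continuous_real) auto
    have cuv: "continuous_on {?u..?v} f" using u by (intro c) auto
    have "integral {?u..?v} (\<lambda>x. f (s k) - f x) = f (s k) * (?v - ?u) - integral {?u..?v} f"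
      using u cuv
      by (subst Henstock_Kurzweil_Integration.integral_diff) (auto intro: integrable_continuous_real)
    moreover have "norm (integral {?u..?v} (\<lambda>x. f (s k) - f x)) \<le> e * (?v - ?u)"
      using u cuv osc[of k] Suc.prems by (intro integral_bound) (auto intro!: continuous_intros)
    ultimately have "\<bar>f (s k) * (?v - ?u) - integral {?u..?v} f\<bar> \<le> e * (?v - ?u)"
      by simp
    with Suc show ?case by (simp add: split abs_le_iff algebra_simps)
  qed
  from this[of n] show ?thesis by (simp add: tn)
qed

lemma continuous_imp_riemann_integrable_UNIV:
  assumes "a < b" "continuous_in UNIV a b f"
  shows "riemann_integrable_in UNIV a b f"
proof -
  \<comment> \<open>For the whole line the definition relative to \<open>F\<close> is ordinary
    continuity, so compactness of the interval becomes available.\<close>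
  have cont: "continuous_on {a..b} f"
    using assms(2) by (simp add: continuous_on_iff continuous_in_def interval_in_def dist_real_def)
  then have unif: "uniformly_continuous_on {a..b} f"
    by (simp add: compact_uniformly_continuous)
  have "\<exists>\<delta>>0. \<forall>n t s. tagged_partition_in UNIV a b n t s \<and> (\<forall>i<n. t (Suc i) - t i < \<delta>) \<longrightarrow>
      \<bar>(\<Sum>i<n. f (s i) * (t (Suc i) - t i)) - integral {a..b} f\<bar> < \<epsilon>"
    if "\<epsilon> > 0" for \<epsilon>
  proof -
    \<comment> \<open>The factor 2 makes \<open>e * (b - a)\<close> half of \<epsilon>, which turns
      the weak bound of the previous lemma into a strict one.\<close>
    define e where "e = \<epsilon> / (2 * (b - a))"
    have e: "e > 0" "e * (b - a) < \<epsilon>"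
      using assms(1) that by (simp_all add: e_def field_simps)
    obtain \<delta> where \<delta>: "\<delta> > 0"
      "\<And>x y. x \<in> {a..b} \<Longrightarrow> y \<in> {a..b} \<Longrightarrow> \<bar>y - x\<bar> < \<delta> \<Longrightarrow> \<bar>f y - f x\<bar> < e"
      using unif e(1) unfolding uniformly_continuous_on_def dist_real_def by metis
    have "\<bar>(\<Sum>i<n. f (s i) * (t (Suc i) - t i)) - integral {a..b} f\<bar> < \<epsilon>"
      if part: "tagged_partition_in UNIV a b n t s" and mesh: "\<forall>i<n. t (Suc i) - t i < \<delta>" for n t s
    proof -
      have t0: "t 0 = a" and tn: "t n = b"
        and s: "\<And>i. i < n \<Longrightarrow> s i \<in> {t i..t (Suc i)}"
        using part by (auto simp: tagged_partition_in_def interval_in_def)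
      note mono = tagged_partition_in_mono[OF part]
      have "\<bar>f (s i) - f x\<bar> \<le> e" if "i < n" "x \<in> {t i..t (Suc i)}" for i x
      proof -
        have "a \<le> t i" "t (Suc i) \<le> b"
          using mono[of 0 i] mono[of "Suc i" n] that by (auto simp: t0 tn)
        moreover have "\<bar>s i - x\<bar> < \<delta>"
          using s[of i] that mesh by (fastforce simp: abs_less_iff)
        ultimately show ?thesis
          using \<delta>(2)[of x "s i"] s[of i] that by fastforce
      qed
      from riemann_sum_integral_bound[OF cont part this] e(2) show ?thesis by simp
    qed
    with \<delta>(1) show ?thesis by blast
  qed
  then show ?thesis
    using assms(1) by (auto simp: riemann_integrable_in_def has_integral_in_def)
qed

section \<open>Fine partitions and uniqueness of the integral\<close>

lemma ex_tagged_partition_in: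
  assumes F: "real_subfield F" and "a \<in> F" "b \<in> F" "a < b" "\<delta> > 0"
  obtains n t where "tagged_partition_in F a b n t t" "\<forall>i<n. t (Suc i) - t i < \<delta>"
proof -
  obtain n where n: "(b - a) / \<delta> < real n"
    using reals_Archimedean2 by blast
  have pos: "0 < real n"
    using n assms(4,5) by (smt (verit) divide_pos_pos)
  \<comment> \<open>Equal division keeps all points in \<open>F\<close>. The left endpoints serve as
    sample points, hence the repeated \<open>t\<close> in the conclusion.\<close>
  define t where "t i = a + real i * ((b - a) / real n)" for i
  have h: "t (Suc i) - t i = (b - a) / real n" for i
    by (simp add: t_def algebra_simps add_divide_distrib diff_divide_distrib)
  have h_pos: "(b - a) / real n > 0"
    using pos assms(4) by simp
  have tF: "t i \<in> F" for i
    unfolding t_def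
    by (intro real_subfield_closed[OF F] real_subfield_of_nat[OF F] assms)
  have "t i < t (Suc i)" for i
    using h[of i] h_pos by simp
  then have "tagged_partition_in F a b n t t"
    using pos tF by (auto simp: tagged_partition_in_def interval_in_def less_imp_le t_def)
  moreover have "\<forall>i<n. t (Suc i) - t i < \<delta>"
    using n pos assms(5) by (simp add: h field_simps)
  ultimately show ?thesis by (rule that)
qed

text \<open>A single partition fine enough for both candidates puts one Riemann sum within half
  their distance of each. The existence of arbitrarily fine partitions with points in
  \<open>F\<close> keeps the integral condition from being vacuous.\<close>

lemma has_integral_in_unique:
  assumes F: "real_subfield F" and "a \<in> F" "b \<in> F" "a \<le> b"
    and "has_integral_in F a b f I" "has_integral_in F a b f J"
  shows "I = J"
proof (rule ccontr)
  assume ne: "I \<noteq> J"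
  then have "a < b" "I \<in> F" "J \<in> F"
    using assms(4-6) by (auto simp: has_integral_in_def split: if_splits)
  define \<epsilon> where "\<epsilon> = \<bar>I - J\<bar> / 2"
  \<comment> \<open>The definition of the integral only speaks of tolerances in \<open>F\<close>, so
    \<epsilon> has to be shown to lie there.\<close>
  have "\<bar>I - J\<bar> \<in> F"
    using \<open>I \<in> F\<close> \<open>J \<in> F\<close> by (auto simp: abs_if intro: real_subfield_diff[OF F])
  then have "\<epsilon> \<in> F" "\<epsilon> > 0"
    using real_subfield_divide[OF F _ real_subfield_of_nat[OF F, of 2]] ne by (auto simp: \<epsilon>_def)
  let ?close = "\<lambda>K \<delta>. \<forall>n t s. tagged_partition_in F a b n t s \<and> (\<forall>i<n. t (Suc i) - t i < \<delta>) \<longrightarrow>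
      \<bar>(\<Sum>i<n. f (s i) * (t (Suc i) - t i)) - K\<bar> < \<epsilon>"
  obtain d1 where d1: "d1 > 0" "?close I d1"
    using assms(5) \<open>a < b\<close> \<open>\<epsilon> \<in> F\<close> \<open>\<epsilon> > 0\<close> by (auto simp: has_integral_in_def)
  obtain d2 where d2: "d2 > 0" "?close J d2"
    using assms(6) \<open>a < b\<close> \<open>\<epsilon> \<in> F\<close> \<open>\<epsilon> > 0\<close> by (auto simp: has_integral_in_def)
  obtain n t where t: "tagged_partition_in F a b n t t" "\<forall>i<n. t (Suc i) - t i < min d1 d2"
    using ex_tagged_partition_in[OF F assms(2,3) \<open>a < b\<close>, of "min d1 d2"] d1(1) d2(1) by auto
  have "\<bar>(\<Sum>i<n. f (t i) * (t (Suc i) - t i)) - I\<bar> < \<epsilon>"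
    using d1(2) t by simp
  moreover have "\<bar>(\<Sum>i<n. f (t i) * (t (Suc i) - t i)) - J\<bar> < \<epsilon>"
    using d2(2) t by simp
  ultimately show False by (simp add: \<epsilon>_def abs_if split: if_splits)
qed

section \<open>A continuous function that is not integrable around a gap\<close>

lemma ex_subinterval_containing:
  fixes t :: "nat \<Rightarrow> 'a::linorder"
  assumes "t 0 \<le> c" "c < t n"
  shows "\<exists>k<n. t k \<le> c \<and> c < t (Suc k)"
  using assms(2)
proof (induction n)
  case 0
  then show ?case using assms(1) by simp
next
  case (Suc n)
  then show ?case by (cases "c < t n") (auto simp: not_less less_Suc_eq)
qed

text \<open>Integrability would force any two Riemann sums over the same fine partition to differ by
  less than 2. Moving the one sample point next to \<open>c\<close> to a place where
  \<open>f\<close> is huge changes the sum by more than that.\<close>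

lemma not_riemann_integrable_in_if_unbounded:
  assumes F: "real_subfield F" and ab: "a \<in> F" "b \<in> F" and c: "a < c" "c < b" "c \<notin> F"
    and unbounded: "\<And>u M. u < c \<Longrightarrow> \<exists>x\<in>F. u < x \<and> x < c \<and> f x > M"
  shows "\<not> riemann_integrable_in F a b f"
proof
  assume "riemann_integrable_in F a b f"
  then obtain I where "has_integral_in F a b f I"
    by (auto simp: riemann_integrable_in_def)
  then obtain \<delta> where \<delta>: "\<delta> > 0"
    and close: "\<And>n t s. tagged_partition_in F a b n t s \<Longrightarrow> \<forall>i<n. t (Suc i) - t i < \<delta> \<Longrightarrow>
      \<bar>(\<Sum>i<n. f (s i) * (t (Suc i) - t i)) - I\<bar> < 1"
    using c real_subfield_1[OF F] unfolding has_integral_in_def by fastforce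
  obtain n t where t: "tagged_partition_in F a b n t t" "\<forall>i<n. t (Suc i) - t i < \<delta>"
    using ex_tagged_partition_in[OF F ab _ \<delta>] c by auto
  obtain k where k: "k < n" "t k \<le> c" "c < t (Suc k)"
    using ex_subinterval_containing[of t c n] t(1) c by (auto simp: tagged_partition_in_def)
  have "t k \<in> F"
    using t(1) k(1) by (simp add: tagged_partition_in_def)
  \<comment> \<open>Since \<open>c\<close> is not in \<open>F\<close>, it is no partition point;
    this leaves room for the new sample point between \<open>t k\<close> and
    \<open>c\<close>.\<close>
  then have "t k < c"
    using k(2) c(3) by (metis order_less_le)
  define h where "h = t (Suc k) - t k"
  have "h > 0" using k by (simp add: h_def)
  \<comment> \<open>The surplus \<open>2 / h\<close>, multiplied by the length \<open>h\<close> of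
    the subinterval, yields a change of the sum beyond 2.\<close>
  obtain x where x: "x \<in> F" "t k < x" "x < c" "f x > f (t k) + 2 / h"
    using unbounded[OF \<open>t k < c\<close>] by blast
  let ?s = "t(k := x)"
  have "tagged_partition_in F a b n t ?s"
    using t(1) x k by (auto simp: tagged_partition_in_def interval_in_def)
  then have "\<bar>(\<Sum>i<n. f (?s i) * (t (Suc i) - t i)) - I\<bar> < 1"
    using t(2) by (rule close)
  moreover have "\<bar>(\<Sum>i<n. f (t i) * (t (Suc i) - t i)) - I\<bar> < 1"
    using t by (rule close)
  moreover have "(\<Sum>i<n. f (?s i) * (t (Suc i) - t i)) - (\<Sum>i<n. f (t i) * (t (Suc i) - t i))
      = (f x - f (t k)) * h"
  proof -
    have "(\<Sum>i<n. f (?s i) * (t (Suc i) - t i)) - (\<Sum>i<n. f (t i) * (t (Suc i) - t i))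
        = (\<Sum>i<n. if i = k then (f x - f (t k)) * h else 0)"
      unfolding sum_subtractf[symmetric] by (rule sum.cong) (auto simp: h_def algebra_simps)
    then show ?thesis using k(1) by simp
  qed
  moreover have "(f x - f (t k)) * h > 2"
    using x(4) pos_divide_less_eq[OF \<open>h > 0\<close>, of 2 "f x - f (t k)"] by simp
  ultimately show False by linarith
qed

lemma floor_inverse_distance_continuous_in:
  assumes F: "real_subfield F" and c: "c \<notin> F"
  shows "continuous_in F a b (\<lambda>x. of_int \<lfloor>1 / (c - x)\<rfloor>)"
  unfolding continuous_in_def
proof (intro ballI impI)
  fix x \<epsilon>
  assume "x \<in> interval_in F a b" and \<epsilon>: "0 < (\<epsilon>::real)"
  then have "x \<in> F" by (simp add: interval_in_def)
  have "c \<noteq> x" using c \<open>x \<in> F\<close> by blast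
  have "1 / (c - x) \<notin> \<int>"
  proof
    assume "1 / (c - x) \<in> \<int>"
    then obtain z where z: "1 / (c - x) = of_int z"
      by (rule Ints_cases)
    \<comment> \<open>Solving for \<open>c\<close> exhibits it as an element of \<open>F\<close>.
      The case of \<open>z\<close> being 0 is covered by the convention that division by 0 gives
      0.\<close>
    have "c = x + 1 / of_int z"
      by (simp flip: z)
    then show False
      using c \<open>x \<in> F\<close> by (simp add: real_subfield_closed[OF F] real_subfield_of_int[OF F])
  qed
  moreover have "isCont (\<lambda>y. 1 / (c - y)) x"
    using \<open>c \<noteq> x\<close> by (intro continuous_intros) auto
  \<comment> \<open>The floor of a function is locally constant where the function is continuous and
    its value is not an integer.\<close>
  ultimately have "\<forall>\<^sub>F y in at x. \<lfloor>1 / (c - y)\<rfloor> = \<lfloor>1 / (c - x)\<rfloor>"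
    by (intro eventually_floor_eq) (auto simp: isCont_def)
  then obtain d where d: "d > 0" "\<And>y. y \<noteq> x \<Longrightarrow> \<bar>y - x\<bar> < d \<Longrightarrow> \<lfloor>1 / (c - y)\<rfloor> = \<lfloor>1 / (c - x)\<rfloor>"
    by (auto simp: eventually_at dist_real_def)
  \<comment> \<open>The radius \<open>d\<close> is merely real; density shrinks it to one in
    \<open>F\<close>.\<close>
  obtain \<delta> where \<delta>: "\<delta> \<in> F" "0 < \<delta>" "\<delta> < d"
    using real_subfield_dense[OF F d(1)] .
  have "\<bar>real_of_int \<lfloor>1 / (c - y)\<rfloor> - real_of_int \<lfloor>1 / (c - x)\<rfloor>\<bar> < \<epsilon>" if "\<bar>y - x\<bar> < \<delta>" for y
    using d(2)[of y] that \<delta> \<epsilon> by (cases "y = x") auto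
  with \<delta> show "\<exists>\<delta>\<in>F. \<delta> > 0 \<and> (\<forall>y\<in>interval_in F a b. \<bar>y - x\<bar> < \<delta> \<longrightarrow>
      \<bar>real_of_int \<lfloor>1 / (c - y)\<rfloor> - real_of_int \<lfloor>1 / (c - x)\<rfloor>\<bar> < \<epsilon>)"
    by blast
qed

lemma floor_inverse_distance_unbounded:
  fixes c :: real
  assumes F: "real_subfield F" and "u < c"
  shows "\<exists>x\<in>F. u < x \<and> x < c \<and> of_int \<lfloor>1 / (c - x)\<rfloor> > (M::real)"
proof -
  \<comment> \<open>The added 1 absorbs the rounding down by the floor, and the absolute value makes
    \<open>N\<close> positive, so that \<open>1 / N\<close> is a genuine distance to the left of
    \<open>c\<close>.\<close>
  define N where "N = \<bar>M\<bar> + 1"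
  have "N > 0" by (simp add: N_def)
  then have "max u (c - 1 / N) < c"
    using assms(2) by simp
  then obtain x where x: "x \<in> F" "max u (c - 1 / N) < x" "x < c"
    using real_subfield_dense[OF F] by blast
  then have "1 / (c - x) > N"
    using \<open>N > 0\<close> by (simp add: field_simps)
  then have "of_int \<lfloor>1 / (c - x)\<rfloor> > M"
    unfolding N_def by linarith
  with x show ?thesis by auto
qed

lemma ex_continuous_not_riemann_integrable_in:
  assumes F: "real_subfield F" and c: "c \<notin> F"
  obtains a b f where "a \<in> F" "b \<in> F" "a < b" "f \<in> interval_in F a b \<rightarrow> F"
    "continuous_in F a b f" "\<not> riemann_integrable_in F a b f"
proof -
  let ?f = "\<lambda>x. real_of_int \<lfloor>1 / (c - x)\<rfloor>"
  obtain a where a: "a \<in> F" "c - 1 < a" "a < c"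
    using real_subfield_dense[OF F, of "c - 1" c] by auto
  obtain b where b: "b \<in> F" "c < b" "b < c + 1"
    using real_subfield_dense[OF F, of c "c + 1"] by auto
  show ?thesis
  proof
    show "a \<in> F" "b \<in> F" "a < b" using a b by auto
    show "?f \<in> interval_in F a b \<rightarrow> F"
      by (simp add: real_subfield_of_int[OF F])
    show "continuous_in F a b ?f"
      by (rule floor_inverse_distance_continuous_in[OF F c])
    show "\<not> riemann_integrable_in F a b ?f"
      by (rule not_riemann_integrable_in_if_unbounded[OF F a(1) b(1) a(3) b(2) c])
         (rule floor_inverse_distance_unbounded[OF F])
  qed
qed

section \<open>The equivalence and the area function\<close>

lemma complete_in_UNIV: "complete_in UNIV"
  unfolding complete_in_def
proof (intro allI impI)
  fix S :: "real set"
  assume "S \<subseteq> UNIV \<and> S \<noteq> {} \<and> (\<exists>u\<in>UNIV. \<forall>x\<in>S. x \<le> u)"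
  then have "S \<noteq> {}" "bdd_above S" by (auto simp: bdd_above_def)
  then show "\<exists>s\<in>UNIV. (\<forall>x\<in>S. x \<le> s) \<and> (\<forall>u\<in>UNIV. (\<forall>x\<in>S. x \<le> u) \<longrightarrow> s \<le> u)"
    by (intro bexI[of _ "Sup S"]) (auto intro: cSup_upper cSup_least)
qed

theorem theorem2:
  fixes F :: "real set"
  assumes "real_subfield F"
  shows "(complete_in F \<longleftrightarrow>
            (\<forall>a\<in>F. \<forall>b\<in>F. a < b \<longrightarrow>
              (\<forall>f \<in> interval_in F a b \<rightarrow> F.
                continuous_in F a b f \<longrightarrow> riemann_integrable_in F a b f))) \<and>
         ((\<forall>a\<in>F. \<forall>b\<in>F. a < b \<longrightarrow>
              (\<forall>f \<in> interval_in F a b \<rightarrow> F.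
                continuous_in F a b f \<longrightarrow> riemann_integrable_in F a b f)) \<longrightarrow>
            (\<forall>a\<in>F. \<forall>b\<in>F. a < b \<longrightarrow>
              (\<forall>f \<in> interval_in F a b \<rightarrow> F. continuous_in F a b f \<longrightarrow>
                (\<forall>x \<in> interval_in F a b. \<exists>!y. y \<in> F \<and> has_integral_in F a x f y))))"
    (is "(_ \<longleftrightarrow> ?int) \<and> (_ \<longrightarrow> ?area)")
proof (intro conjI impI)
  note F = assms
  show "complete_in F \<longleftrightarrow> ?int"
  proof
    assume "complete_in F"
    then have "F = UNIV" by (rule complete_in_imp_UNIV[OF F])
    then show ?int by (simp add: continuous_imp_riemann_integrable_UNIV)
  next
    assume int: ?int
    have "F = UNIV"
    proof (rule ccontr)
      assume "F \<noteq> UNIV"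
      then obtain c where "c \<notin> F" by blast
      then show False
        using int by (metis ex_continuous_not_riemann_integrable_in[OF F])
    qed
    then show "complete_in F" using complete_in_UNIV by simp
  qed
  assume int: ?int
  show ?area
  proof (intro ballI impI)
    fix a b f x
    assume a: "a \<in> F" and f: "f \<in> interval_in F a b \<rightarrow> F" "continuous_in F a b f"
      and x: "x \<in> interval_in F a b"
    have xF: "x \<in> F" "a \<le> x" using x by (auto simp: interval_in_def)
    have sub: "interval_in F a x \<subseteq> interval_in F a b"
      using x by (auto simp: interval_in_def)
    \<comment> \<open>Continuity passes to the shorter interval, so \<open>int\<close> applies to it
      when \<open>a < x\<close>; for \<open>x\<close> equal to \<open>a\<close> the value 0 is fixed
      by convention.\<close>
    have "\<exists>y\<in>F. has_integral_in F a x f y"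
    proof (cases "a = x")
      case True
      then show ?thesis using real_subfield_0[OF F] by (simp add: has_integral_in_def)
    next
      case False
      have "continuous_in F a x f"
        using f(2) sub unfolding continuous_in_def by (meson subsetD)
      moreover have "f \<in> interval_in F a x \<rightarrow> F"
        using f(1) sub by blast
      ultimately show ?thesis
        using int a xF False by (simp add: riemann_integrable_in_def)
    qed
    then show "\<exists>!y. y \<in> F \<and> has_integral_in F a x f y"
      using has_integral_in_unique[OF F a xF] by blast
  qed
qed

end
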